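(* For $n\ge0$, let $a_n$ be the number of $2\times n$ Nurikabe grids. Then $a_n=6\cdot 2^n-3n-5$ for all $n\ge 0$.
   Context: A $2\times n$ Nurikabe grid is a coloring of the cells of a $2\times n$ grid with black and white such that (1) the set of black cells is edge-connected (it forms a polyomino; the empty set of black cells is allowed) and (2) no $2\times2$ subgrid consists entirely of black cells. For $n=0$ there is exactly one (empty) grid. *)

theory Defs
  imports Main "HOL-Library.FuncSet"
begin

datatype colour = Black | White

type_synonym cell = "nat \<times> nat"

definition cells :: "nat \<Rightarrow> nat \<Rightarrow> cell set" where
  "cells m n = {..<m} \<times> {..<n}"

definition edge_adjacent :: "cell \<Rightarrow> cell \<Rightarrow> bool" where
  "edge_adjacent p q \<longleftrightarrow>
     (fst p = fst q \<and> (snd q = Suc (snd p) \<or> snd p = Suc (snd q))) \<or>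
     (snd p = snd q \<and> (fst q = Suc (fst p) \<or> fst p = Suc (fst q)))"

text \<open>The empty set counts as edge-connected.\<close>

definition edge_connected :: "cell set \<Rightarrow> bool" where
  "edge_connected B \<longleftrightarrow>
     (\<forall>p\<in>B. \<forall>q\<in>B. (p, q) \<in> {(x, y). x \<in> B \<and> y \<in> B \<and> edge_adjacent x y}\<^sup>*)"

definition black_cells :: "nat \<Rightarrow> nat \<Rightarrow> (cell \<Rightarrow> colour) \<Rightarrow> cell set" where
  "black_cells m n f = {p \<in> cells m n. f p = Black}"

definition has_black_square :: "nat \<Rightarrow> nat \<Rightarrow> (cell \<Rightarrow> colour) \<Rightarrow> bool" where
  "has_black_square m n f \<longleftrightarrow>
     (\<exists>i j. {(i, j), (i, Suc j), (Suc i, j), (Suc i, Suc j)} \<subseteq> black_cells m n f)"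

text \<open>
  Colourings are extensional functions on the cells, so that two colourings are equal iff
  they agree on the grid; in particular there is exactly one colouring of the empty grid.
\<close>

definition nurikabe_grids :: "nat \<Rightarrow> nat \<Rightarrow> (cell \<Rightarrow> colour) set" where
  "nurikabe_grids m n =
     {f \<in> cells m n \<rightarrow>\<^sub>E UNIV. edge_connected (black_cells m n f) \<and> \<not> has_black_square m n f}"

end

theory Submission
  imports Defs
begin

text \<open>
  Build the grid column by column. A nonempty column \<open>S\<close> can be appended to a grid that
  already contains a black cell iff the grid is valid and its last column \<open>R\<close> meets
  \<open>S\<close> in exactly one row: they must meet for connectedness, and two common rows would be a
  black square. Each of the three nonempty \<open>S\<close> meets exactly two of the three nonempty
  \<open>R\<close> in one row, so the number \<open>c\<close> of grids with prescribed nonempty last column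
  satisfies \<open>c (n + 1) = 2 * c n + 1\<close>, the summand 1 accounting for the grid whose other
  columns are all white. Hence \<open>c n = 2 ^ n - 1\<close> and \<open>a (n + 1) = a n + 3 * c (n + 1)\<close>.
\<close>

section \<open>Edge-connected sets\<close>

abbreviation adj_on :: "cell set \<Rightarrow> (cell \<times> cell) set" where
  "adj_on B \<equiv> {(x, y). x \<in> B \<and> y \<in> B \<and> edge_adjacent x y}"

lemma edge_adjacent_sym: "edge_adjacent p q \<Longrightarrow> edge_adjacent q p"
  by (auto simp: edge_adjacent_def)

lemma edge_connected_empty: "edge_connected {}"
  by (simp add: edge_connected_def)

text \<open>A map that sends every edge to an edge or to a single cell turns paths into paths. This
  is applied to a retraction that removes the last column.\<close>

lemma edge_connected_image:
  assumes "edge_connected A"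
    and step: "\<And>x y. x \<in> A \<Longrightarrow> y \<in> A \<Longrightarrow> edge_adjacent x y \<Longrightarrow>
                 g x = g y \<or> edge_adjacent (g x) (g y)"
  shows "edge_connected (g ` A)"
proof -
  have "(g p, g q) \<in> (adj_on (g ` A))\<^sup>*" if "(p, q) \<in> (adj_on A)\<^sup>*" for p q
    using that
  proof (induction rule: rtrancl_induct)
    case (step y z)
    then have "g y = g z \<or> (g y, g z) \<in> adj_on (g ` A)"
      using assms(2) by auto
    with step.IH show ?case by (metis (no_types, lifting) rtrancl.rtrancl_into_rtrancl)
  qed simp
  with assms(1) show ?thesis by (auto simp: edge_connected_def)
qed

lemma edge_connected_Un:
  assumes A: "edge_connected A" and B: "edge_connected B"
    and pq: "p \<in> A" "q \<in> B" "edge_adjacent p q"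
  shows "edge_connected (A \<union> B)"
proof -
  let ?R = "(adj_on (A \<union> B))\<^sup>*"
  have subA: "(adj_on A)\<^sup>* \<subseteq> ?R" and subB: "(adj_on B)\<^sup>* \<subseteq> ?R"
    by (intro rtrancl_mono; auto)+
  have inA: "(x, y) \<in> ?R" if "x \<in> A" "y \<in> A" for x y
    using A subA that unfolding edge_connected_def by blast
  have inB: "(x, y) \<in> ?R" if "x \<in> B" "y \<in> B" for x y
    using B subB that unfolding edge_connected_def by blast
  have AB: "(p, q) \<in> ?R" and BA: "(q, p) \<in> ?R"
    using pq edge_adjacent_sym[OF pq(3)] by (auto intro!: r_into_rtrancl)
  \<comment> \<open>The cell \<open>p\<close> acts as a hub: every cell is linked to it in both
    directions, so any two cells are linked through it.\<close>
  have "(x, p) \<in> ?R \<and> (p, x) \<in> ?R" if "x \<in> A \<union> B" for x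
    using that
  proof
    assume "x \<in> A"
    then show ?thesis using inA pq(1) by blast
  next
    assume "x \<in> B"
    then have "(x, q) \<in> ?R" "(q, x) \<in> ?R" using inB pq(2) by blast+
    with AB BA show ?thesis by (meson rtrancl_trans)
  qed
  then show ?thesis
    unfolding edge_connected_def by (meson rtrancl_trans)
qed

text \<open>A path from \<open>A\<close> to \<open>B\<close> has to leave \<open>A\<close> along
  some edge; without such an edge, induction along the path keeps it inside
  \<open>A\<close>.\<close>

lemma edge_connected_crossing:
  assumes "edge_connected (A \<union> B)" "A \<noteq> {}" "B \<noteq> {}" "A \<inter> B = {}"
  obtains p q where "p \<in> A" "q \<in> B" "edge_adjacent p q"
proof -
  obtain a b where ab: "a \<in> A" "b \<in> B" using assms by blast
  then have "(a, b) \<in> (adj_on (A \<union> B))\<^sup>*"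
    using assms(1) by (simp add: edge_connected_def)
  moreover have "y \<in> A" if "(a, y) \<in> (adj_on (A \<union> B))\<^sup>*"
    and "\<not> (\<exists>p\<in>A. \<exists>q\<in>B. edge_adjacent p q)" for y
    using that(1) by (induction rule: rtrancl_induct) (use ab that(2) in auto)
  ultimately show thesis using ab assms(4) that by blast
qed

section \<open>Appending a column\<close>

definition column :: "nat \<Rightarrow> cell set \<Rightarrow> nat set" where
  "column j B = {i. (i, j) \<in> B}"

text \<open>The Nurikabe condition on the black set alone, for cells in two rows, where a square
  must occupy rows 0 and 1. The width of the grid does not enter, so white columns on the right can
  be added or dropped freely.\<close>

definition admissible :: "cell set \<Rightarrow> bool" where
  "admissible B \<longleftrightarrow> edge_connected B \<and> (\<nexists>j. {0, 1} \<times> {j, Suc j} \<subseteq> B)"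

lemma edge_connected_column:
  assumes "S \<subseteq> {..<2::nat}"
  shows "edge_connected (S \<times> {n})"
  unfolding edge_connected_def
proof (intro ballI)
  fix p q assume p: "p \<in> S \<times> {n}" and q: "q \<in> S \<times> {n}"
  then have "fst p < 2" "fst q < 2" "snd p = n" "snd q = n" using assms by auto
  then have "p = q \<or> edge_adjacent p q"
    by (cases p; cases q) (auto simp: edge_adjacent_def less_2_cases_iff)
  with p q show "(p, q) \<in> (adj_on (S \<times> {n}))\<^sup>*" by auto
qed

lemma admissible_single_column:
  assumes "S \<subseteq> {..<2}"
  shows "admissible (S \<times> {n})"
  using edge_connected_column[OF assms] by (auto simp: admissible_def)

lemma card_rows_eq_1:
  assumes "X \<subseteq> {..<2::nat}"
  shows "card X = 1 \<longleftrightarrow> X \<noteq> {} \<and> X \<noteq> {0, 1}"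
proof -
  have "X \<in> Pow {0, 1}" using assms by (auto simp: less_2_cases_iff)
  then have "X = {} \<or> X = {0} \<or> X = {1} \<or> X = {0, 1}"
    by auto
  then show ?thesis by (auto simp: doubleton_eq_iff)
qed

text \<open>From left to right, some edge joins \<open>B\<close> to the new column, and
  \<open>B\<close> is connected as the image of the whole set under a retraction. From right to
  left, a common row supplies the joining edge, and a new square would need both rows in
  common.\<close>

lemma admissible_append:
  assumes B: "B \<subseteq> cells 2 (Suc m)" "B \<noteq> {}" and S: "S \<subseteq> {..<2}" "S \<noteq> {}"
  shows "admissible (B \<union> S \<times> {Suc m}) \<longleftrightarrow> admissible B \<and> card (column m B \<inter> S) = 1"
    (is "admissible ?B' \<longleftrightarrow> _")
proof
  have card1: "card (column m B \<inter> S) = 1 \<longleftrightarrow>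
      column m B \<inter> S \<noteq> {} \<and> column m B \<inter> S \<noteq> {0, 1}"
    using S(1) by (intro card_rows_eq_1) auto
  have bound: "i < 2" "j \<le> m" if "(i, j) \<in> B" for i j
    using that B(1) by (auto simp: cells_def)
  {
    assume ok: "admissible ?B'"
    have "B \<inter> S \<times> {Suc m} = {}" using bound(2) by fastforce
    moreover have "S \<times> {Suc m} \<noteq> {}" using S(2) by simp
    moreover have "edge_connected ?B'" using ok by (simp add: admissible_def)
    ultimately obtain p q where pq: "p \<in> B" "q \<in> S \<times> {Suc m}" "edge_adjacent p q"
      using edge_connected_crossing B(2) by blast
    obtain r j where p: "p = (r, j)" by (cases p)
    have "j \<le> m" using pq(1) bound(2) p by blast
    \<comment> \<open>An edge from a column up to \<open>m\<close> into column \<open>Suc m\<close>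
      is horizontal and starts in column \<open>m\<close>.\<close>
    then have "j = m" "r \<in> S" using pq(2,3) p by (auto simp: edge_adjacent_def)
    with pq(1) p have r: "(r, m) \<in> B" "r \<in> S" by auto
    have "column m B \<inter> S \<noteq> {0, 1}"
    proof
      assume "column m B \<inter> S = {0, 1}"
      then have "{0, 1} \<times> {m, Suc m} \<subseteq> ?B'" by (auto simp: column_def)
      with ok show False unfolding admissible_def by blast
    qed
    with r have "card (column m B \<inter> S) = 1"
      unfolding card1 by (auto simp: column_def)
    moreover
    \<comment> \<open>The new column retracts onto column \<open>m\<close>, which has a black cell.\<close>
    define g :: "cell \<Rightarrow> cell" where
      "g p = (if p \<in> B then p else if (fst p, m) \<in> B then (fst p, m) else (r, m))" for p
    have "edge_connected (g ` ?B')"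
    proof (rule edge_connected_image)
      show "edge_connected ?B'" using ok by (simp add: admissible_def)
      fix x y assume xy: "x \<in> ?B'" "y \<in> ?B'" "edge_adjacent x y"
      \<comment> \<open>With only two rows, any two cells of a column are equal or adjacent. Hence
        sending a new cell without black left neighbour to the fixed row \<open>r\<close> does no
        harm.\<close>
      have vert: "a = b \<or> edge_adjacent (a, m) (b, m)" if "(a, m) \<in> B" "(b, m) \<in> B" for a b
        using bound(1)[OF that(1)] bound(1)[OF that(2)]
        by (auto simp: edge_adjacent_def less_2_cases_iff)
      obtain a j b k where [simp]: "x = (a, j)" "y = (b, k)" by (cases x; cases y)
      have img: "\<exists>c. g p = (c, m) \<and> (c, m) \<in> B" if "p \<in> ?B'" "snd p \<ge> m" for p
        using that r bound(2) by (cases p) (fastforce simp: g_def)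
      \<comment> \<open>A cell outside \<open>B\<close> lies in column \<open>Suc m\<close>, so its
        neighbours lie in column \<open>m\<close> or beyond.\<close>
      consider "j \<ge> m" "k \<ge> m" | "x \<in> B" "y \<in> B"
        using xy bound(2) by (fastforce simp: edge_adjacent_def)
      then show "g x = g y \<or> edge_adjacent (g x) (g y)"
      proof cases
        case 1
        then obtain c d where "g x = (c, m)" "(c, m) \<in> B" "g y = (d, m)" "(d, m) \<in> B"
          using img[OF xy(1)] img[OF xy(2)] by auto
        then show ?thesis using vert[of c d] by auto
      next
        case 2
        then show ?thesis using xy by (simp add: g_def)
      qed
    qed
    moreover have "g ` ?B' = B"
    proof
      show "g ` ?B' \<subseteq> B" using r by (auto simp: g_def)
      show "B \<subseteq> g ` ?B'" by (force simp: g_def image_iff)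
    qed
    ultimately show "admissible B \<and> card (column m B \<inter> S) = 1"
      using ok unfolding admissible_def by (metis le_supI1)
  }
  {
    assume ok: "admissible B \<and> card (column m B \<inter> S) = 1"
    then obtain r where r: "(r, m) \<in> B" "r \<in> S"
      unfolding card1 by (auto simp: column_def)
    have "edge_connected ?B'"
    proof (rule edge_connected_Un)
      show "edge_connected B" using ok by (simp add: admissible_def)
      show "edge_connected (S \<times> {Suc m})" using S(1) by (rule edge_connected_column)
      show "(r, m) \<in> B" "(r, Suc m) \<in> S \<times> {Suc m}" using r by auto
      show "edge_adjacent (r, m) (r, Suc m)" by (simp add: edge_adjacent_def)
    qed
    moreover have "\<not> {0, 1} \<times> {j, Suc j} \<subseteq> ?B'" for j
    proof
      assume sq: "{0, 1} \<times> {j, Suc j} \<subseteq> ?B'"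
      then have mem: "(i, k) \<in> ?B'" if "i \<in> {0, 1}" "k \<in> {j, Suc j}" for i k
        using that by blast
      have "\<not> {0, 1} \<times> {j, Suc j} \<subseteq> B" using ok by (auto simp: admissible_def)
      \<comment> \<open>A square not contained in \<open>B\<close> uses the new column; it cannot
        start there, because column \<open>Suc (Suc m)\<close> is white.\<close>
      then have "j = m \<or> j = Suc m" using sq by auto
      moreover have "j \<noteq> Suc m" using mem[of 0 "Suc j"] bound(2) by force
      ultimately have "j = m" by blast
      have "i \<in> column m B \<inter> S" if "i \<in> {0, 1}" for i
        using mem[OF that, of m] mem[OF that, of "Suc m"] bound(2) \<open>j = m\<close>
        by (fastforce simp: column_def)
      then have "{0, 1} \<subseteq> column m B \<inter> S" by blast
      moreover have "column m B \<inter> S \<subseteq> {0, 1}" using S(1) by (auto simp: less_2_cases_iff)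
      ultimately show False using ok card1 by blast
    qed
    ultimately show "admissible ?B'" by (simp add: admissible_def)
  }
qed

section \<open>Counting\<close>

definition admissible_sets :: "nat \<Rightarrow> cell set set" where
  "admissible_sets n = {B. B \<subseteq> cells 2 n \<and> admissible B}"

text \<open>Here \<open>n\<close> is the index of the last column, so the grids have width
  \<open>Suc n\<close>.\<close>

definition ending_in :: "nat set \<Rightarrow> nat \<Rightarrow> cell set set" where
  "ending_in S n = {B \<in> admissible_sets (Suc n). column n B = S}"

lemma finite_cells: "finite (cells m n)"
  by (simp add: cells_def)

lemma finite_admissible_sets: "finite (admissible_sets n)"
  by (rule finite_subset[of _ "Pow (cells 2 n)"])
    (auto simp: admissible_sets_def finite_cells)

lemma finite_ending_in: "finite (ending_in S n)"
  by (simp add: ending_in_def finite_admissible_sets)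

lemma black_square_iff:
  "has_black_square 2 n f \<longleftrightarrow> (\<exists>j. {0, 1} \<times> {j, Suc j} \<subseteq> black_cells 2 n f)"
proof
  assume "has_black_square 2 n f"
  then obtain i j where *: "{(i, j), (i, Suc j), (Suc i, j), (Suc i, Suc j)} \<subseteq> black_cells 2 n f"
    unfolding has_black_square_def by blast
  then have "i = 0" by (auto simp: black_cells_def cells_def)
  with * show "\<exists>j. {0, 1} \<times> {j, Suc j} \<subseteq> black_cells 2 n f" by auto
next
  assume "\<exists>j. {0, 1} \<times> {j, Suc j} \<subseteq> black_cells 2 n f"
  then obtain j where "{0, 1} \<times> {j, Suc j} \<subseteq> black_cells 2 n f" ..
  then have "{(0, j), (0, Suc j), (Suc 0, j), (Suc 0, Suc j)} \<subseteq> black_cells 2 n f" by auto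
  then show "has_black_square 2 n f" unfolding has_black_square_def by blast
qed

text \<open>An extensional colouring is determined by its black cells; \<open>g\<close> recovers
  it.\<close>

lemma card_nurikabe_grids: "card (nurikabe_grids 2 n) = card (admissible_sets n)"
proof (rule bij_betw_same_card)
  define g :: "cell set \<Rightarrow> cell \<Rightarrow> colour" where
    "g B = restrict (\<lambda>p. if p \<in> B then Black else White) (cells 2 n)" for B
  have black_g: "black_cells 2 n (g B) = B" if "B \<subseteq> cells 2 n" for B
    using that by (auto simp: black_cells_def g_def)
  show "bij_betw (black_cells 2 n) (nurikabe_grids 2 n) (admissible_sets n)"
  proof (rule bij_betwI[where g = g])
    show "black_cells 2 n \<in> nurikabe_grids 2 n \<rightarrow> admissible_sets n"
      by (auto simp: nurikabe_grids_def admissible_sets_def admissible_def black_square_iff)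
        (auto simp: black_cells_def)
    show "g \<in> admissible_sets n \<rightarrow> nurikabe_grids 2 n"
      by (auto simp: nurikabe_grids_def admissible_sets_def admissible_def black_square_iff black_g)
        (auto simp: g_def)
    show "black_cells 2 n (g B) = B" if "B \<in> admissible_sets n" for B
      using that black_g by (auto simp: admissible_sets_def)
    show "g (black_cells 2 n f) = f" if "f \<in> nurikabe_grids 2 n" for f
    proof
      fix p
      show "g (black_cells 2 n f) p = f p"
        using that
        by (cases p; cases "f p")
          (auto simp: g_def black_cells_def nurikabe_grids_def PiE_def extensional_def)
    qed
  qed
qed

lemma admissible_sets_0: "admissible_sets 0 = {{}}"
  by (auto simp: admissible_sets_def cells_def admissible_def edge_connected_empty)

text \<open>Deleting the last column and restoring it as \<open>S\<close> are mutually
  inverse.\<close>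

lemma card_ending_in_append:
  assumes S: "S \<subseteq> {..<2}"
  shows "card (ending_in S n) = card {B. B \<subseteq> cells 2 n \<and> admissible (B \<union> S \<times> {n})}"
proof (rule bij_betw_same_card[OF bij_betwI])
  show "(\<lambda>B. B - UNIV \<times> {n}) \<in> ending_in S n \<rightarrow> {B. B \<subseteq> cells 2 n \<and> admissible (B \<union> S \<times> {n})}"
  proof
    fix B assume B: "B \<in> ending_in S n"
    then have "B - UNIV \<times> {n} \<union> S \<times> {n} = B" by (auto simp: ending_in_def column_def)
    moreover have "B - UNIV \<times> {n} \<subseteq> cells 2 n"
      using B by (auto simp: ending_in_def admissible_sets_def cells_def less_Suc_eq)
    ultimately show "B - UNIV \<times> {n} \<in> {B. B \<subseteq> cells 2 n \<and> admissible (B \<union> S \<times> {n})}"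
      using B by (simp add: ending_in_def admissible_sets_def)
  qed
  show "(\<lambda>B. B \<union> S \<times> {n}) \<in> {B. B \<subseteq> cells 2 n \<and> admissible (B \<union> S \<times> {n})} \<rightarrow> ending_in S n"
  proof
    fix B assume B: "B \<in> {B. B \<subseteq> cells 2 n \<and> admissible (B \<union> S \<times> {n})}"
    then have "B \<union> S \<times> {n} \<subseteq> cells 2 (Suc n)" "column n (B \<union> S \<times> {n}) = S"
      using S by (auto simp: cells_def column_def)
    with B show "B \<union> S \<times> {n} \<in> ending_in S n"
      by (simp add: ending_in_def admissible_sets_def)
  qed
qed (auto simp: ending_in_def cells_def column_def)

lemma card_ending_in_empty: "card (ending_in {} n) = card (admissible_sets n)"
  by (subst card_ending_in_append) (auto simp: admissible_sets_def)

lemma card_ending_in_0: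
  assumes "S \<subseteq> {..<2}"
  shows "card (ending_in S 0) = 1"
proof -
  have "{B. B \<subseteq> cells 2 0 \<and> admissible (B \<union> S \<times> {0})} = {{}}"
    using admissible_single_column[OF assms] by (auto simp: cells_def)
  then show ?thesis by (simp add: card_ending_in_append[OF assms])
qed

text \<open>The part left of the new column is either empty, giving the summand 1, or is governed by
  \<open>admissible_append\<close> and sorted by its own last column \<open>R\<close>.\<close>

lemma card_ending_in_Suc:
  assumes S: "S \<subseteq> {..<2}" "S \<noteq> {}"
  shows "card (ending_in S (Suc m)) =
    1 + (\<Sum>R | R \<subseteq> {..<2} \<and> card (R \<inter> S) = 1. card (ending_in R m))"
proof -
  let ?I = "{R. R \<subseteq> {..<2} \<and> card (R \<inter> S) = 1}"
  have "{B. B \<subseteq> cells 2 (Suc m) \<and> admissible (B \<union> S \<times> {Suc m})} =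
      insert {} (\<Union>R\<in>?I. ending_in R m)"
  proof (intro set_eqI)
    fix B
    have col: "column m B \<subseteq> {..<2}" if "B \<subseteq> cells 2 (Suc m)"
      using that by (auto simp: column_def cells_def)
    show "B \<in> {B. B \<subseteq> cells 2 (Suc m) \<and> admissible (B \<union> S \<times> {Suc m})} \<longleftrightarrow>
        B \<in> insert {} (\<Union>R\<in>?I. ending_in R m)"
    proof (cases "B = {}")
      case True
      then show ?thesis using admissible_single_column[OF S(1)] by simp
    next
      case False
      then show ?thesis using admissible_append[OF _ False S] col
        by (auto simp: ending_in_def admissible_sets_def)
    qed
  qed
  \<comment> \<open>Each \<open>R\<close> in \<open>?I\<close> meets \<open>S\<close> and so is
    nonempty; thus the empty set is not counted twice.\<close>
  moreover have "{} \<notin> (\<Union>R\<in>?I. ending_in R m)"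
    by (auto simp: ending_in_def column_def)
  moreover have fin: "finite ?I" by (rule finite_subset[of _ "Pow {..<2}"]) auto
  moreover have "card (\<Union>R\<in>?I. ending_in R m) = (\<Sum>R\<in>?I. card (ending_in R m))"
    by (rule card_UN_disjoint) (use fin finite_ending_in in \<open>auto simp: ending_in_def\<close>)
  ultimately show ?thesis
    by (simp add: card_ending_in_append[OF S(1)] finite_ending_in)
qed

lemma Pow_rows: "Pow {..<2::nat} = {{}, {0}, {1}, {0, 1}}"
proof -
  have "{..<2} = {0, 1::nat}" by (auto simp: less_2_cases_iff)
  then show ?thesis by (auto simp: Pow_insert)
qed

lemma card_meeting_rows:
  assumes "S \<subseteq> {..<2::nat}" "S \<noteq> {}"
  shows "card {R. R \<subseteq> {..<2} \<and> card (R \<inter> S) = 1} = 2"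
proof -
  have S: "S = {0} \<or> S = {1} \<or> S = {0, 1}" 
    using assms unfolding Pow_iff[symmetric] Pow_rows by auto
  have "{R. R \<subseteq> {..<2} \<and> card (R \<inter> S) = 1} =
      {R \<in> {{}, {0}, {1}, {0, 1}}. card (R \<inter> S) = 1}"
    unfolding Pow_rows[symmetric] by auto
  also have "\<dots> = (if S = {0} then {{0}, {0, 1}} else if S = {1} then {{1}, {0, 1}} else {{0}, {1}})"
    using S by (elim disjE) (auto simp: doubleton_eq_iff)
  also have "card \<dots> = 2" by (simp add: doubleton_eq_iff)
  finally show ?thesis .
qed

text \<open>The recursion gives \<open>1 + 2 * (2 ^ Suc m - 1) = 2 ^ Suc (Suc m) - 1\<close>. The
  induction varies \<open>S\<close>, since the preceding column \<open>R\<close> may differ from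
  it.\<close>

lemma card_ending_in:
  assumes "S \<subseteq> {..<2}" "S \<noteq> {}"
  shows "card (ending_in S n) + 1 = 2 ^ Suc n"
  using assms
proof (induction n arbitrary: S)
  case 0
  then show ?case by (simp add: card_ending_in_0)
next
  case (Suc m)
  let ?I = "{R. R \<subseteq> {..<2} \<and> card (R \<inter> S) = 1}"
  have "(\<Sum>R\<in>?I. card (ending_in R m)) = (\<Sum>R\<in>?I. 2 ^ Suc m - 1)"
  proof (rule sum.cong)
    fix R assume "R \<in> ?I"
    then have "R \<subseteq> {..<2}" "R \<noteq> {}" by auto
    from Suc.IH[OF this] show "card (ending_in R m) = 2 ^ Suc m - 1" by linarith
  qed simp
  also have "\<dots> = 2 * (2 ^ Suc m - 1)"
    by (simp only: sum_constant card_meeting_rows[OF Suc.prems] of_nat_numeral)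
  finally show ?case
    using one_le_power[of "2::nat" m] unfolding card_ending_in_Suc[OF Suc.prems] power_Suc
    by linarith
qed

text \<open>A white last column leaves an arbitrary admissible set of width \<open>n\<close>; each
  of the three other columns contributes \<open>2 ^ Suc n - 1\<close>. The 3 stands on the left to
  avoid subtraction of naturals.\<close>

lemma card_admissible_sets_Suc:
  "card (admissible_sets (Suc n)) + 3 = card (admissible_sets n) + 3 * 2 ^ Suc n"
proof -
  have "admissible_sets (Suc n) = (\<Union>S\<in>Pow {..<2}. ending_in S n)"
    unfolding ending_in_def admissible_sets_def by (fastforce simp: column_def cells_def)
  then have "card (admissible_sets (Suc n)) = (\<Sum>S\<in>Pow {..<2}. card (ending_in S n))"
    by (simp only:) (rule card_UN_disjoint; auto simp: finite_ending_in; auto simp: ending_in_def)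
  also have "\<dots> = card (ending_in {} n) + card (ending_in {0} n) + card (ending_in {1} n)
      + card (ending_in {0, 1} n)"
    unfolding Pow_rows by (simp add: doubleton_eq_iff)
  finally show ?thesis
    using card_ending_in[of "{0}" n] card_ending_in[of "{1}" n] card_ending_in[of "{0, 1}" n]
    by (simp add: card_ending_in_empty)
qed

theorem theorem11p2:
  fixes n :: nat
  shows "int (card (nurikabe_grids 2 n)) = 6 * 2 ^ n - 3 * int n - 5"
proof (induction n)
  case 0
  then show ?case by (simp add: card_nurikabe_grids admissible_sets_0)
next
  case (Suc n)
  \<comment> \<open>The increment \<open>3 * 2 ^ Suc n - 3\<close> is also that of the closed
    form.\<close>
  have "int (card (admissible_sets (Suc n))) + 3 = int (card (admissible_sets n)) + 3 * 2 ^ Suc n"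
    using arg_cong[OF card_admissible_sets_Suc[of n], of int] by simp
  with Suc show ?case by (simp add: card_nurikabe_grids)
qed

end
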